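(* Let $W:\mathbb{R}^2\to[0,\infty)$ be a $C^3$ function vanishing precisely at two distinct points $\mathbf{p}_+,\mathbf{p}_-$. Suppose there are $r_\pm>0$ and constant, real, symmetric, positive definite $2\times2$ matrices $H_\pm$ such that $$W(p)=(p-\mathbf{p}_\pm)^TH_\pm(p-\mathbf{p}_\pm)\quad\text{for }|p-\mathbf{p}_\pm|<r_\pm .$$ Let $\lambda_1^2,\lambda_2^2$ (with $\lambda_1,\lambda_2>0$) be the eigenvalues of $H_+$. If, for some $\nu\in\mathbb{R}$, there exists a heteroclinic traveling wave with speed $\nu$, i.e. a solution $U:\mathbb{R}\to\mathbb{R}^2$ of $$-\nu\,\mathbb{J}U'=U''-\nabla_uW(U)\ \text{ on }(-\infty,\infty),\qquad U(\pm\infty)=\mathbf{p}_\pm,$$ then $\nu^2\le2(\lambda_1+\lambda_2)^2$.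
   Context: $\mathbb{J}=\begin{pmatrix}0&1\\-1&0\end{pmatrix}$; $U(\pm\infty)=\mathbf{p}_\pm$ means $\lim_{x\to\pm\infty}U(x)=\mathbf{p}_\pm$. *)

theory Defs
  imports "HOL-Analysis.Analysis"
begin

primrec Ck :: "nat \<Rightarrow> ('a::euclidean_space \<Rightarrow> 'b::real_normed_vector) \<Rightarrow> bool" where
  "Ck 0 f \<longleftrightarrow> continuous_on UNIV f"
| "Ck (Suc k) f \<longleftrightarrow> (\<forall>x. f differentiable (at x)) \<and>
     (\<forall>b\<in>Basis. Ck k (\<lambda>x. frechet_derivative f (at x) b))"

definition grad :: "('a::euclidean_space \<Rightarrow> real) \<Rightarrow> 'a \<Rightarrow> 'a" where
  "grad f x = (\<Sum>b\<in>Basis. frechet_derivative f (at x) b *\<^sub>R b)"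

lemma GDERIV_grad:
  assumes "f differentiable (at x)"
  shows "GDERIV f x :> grad f x"
proof -
  let ?D = "frechet_derivative f (at x)"
  have D: "(f has_derivative ?D) (at x)"
    using assms frechet_derivative_works by blast
  then have lin: "linear ?D"
    by (rule has_derivative_linear)
  have "?D h = h \<bullet> grad f x" for h
  proof -
    have "?D h = ?D (\<Sum>b\<in>Basis. (h \<bullet> b) *\<^sub>R b)"
      by (simp add: euclidean_representation)
    also have "\<dots> = (\<Sum>b\<in>Basis. (h \<bullet> b) * ?D b)"
      using lin by (simp add: linear_sum linear_cmul)
    also have "\<dots> = h \<bullet> grad f x"
      by (simp add: grad_def inner_sum_right mult.commute)
    finally show ?thesis .
  qed
  then have "?D = (\<lambda>h. h \<bullet> grad f x)"
    by blast
  with D show ?thesis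
    by (simp add: gderiv_def)
qed

definition J :: "real^2^2" where
  "J = vector [vector [0, 1], vector [-1, 0]]"

definition sym_pos_def :: "real^'n^'n \<Rightarrow> bool" where
  "sym_pos_def H \<longleftrightarrow> transpose H = H \<and> (\<forall>v. v \<noteq> 0 \<longrightarrow> 0 < v \<bullet> (H *v v))"

text \<open>
  For a symmetric 2 by 2 matrix \<open>H\<close>, the set equation \<open>{c. eigenvalue H c} = {a, b}\<close> says that
  \<open>a\<close> and \<open>b\<close> are the eigenvalues of \<open>H\<close> counted with multiplicity: if \<open>H\<close> has only one
  eigenvalue, it is double and the equation forces \<open>a = b\<close>.
\<close>
definition eigenvalue :: "real^'n^'n \<Rightarrow> real \<Rightarrow> bool" where
  "eigenvalue H c \<longleftrightarrow> (\<exists>v. v \<noteq> 0 \<and> H *v v = c *\<^sub>R v)"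

definition heteroclinic_wave ::
    "(real^2 \<Rightarrow> real) \<Rightarrow> real^2 \<Rightarrow> real^2 \<Rightarrow> real \<Rightarrow> (real \<Rightarrow> real^2) \<Rightarrow> bool" where
  "heteroclinic_wave W pm pp \<nu> U \<longleftrightarrow>
     (\<exists>U' U''.
        (\<forall>x. (U has_vector_derivative U' x) (at x)) \<and>
        (\<forall>x. (U' has_vector_derivative U'' x) (at x)) \<and>
        (\<forall>x. - (\<nu> *\<^sub>R (J *v U' x)) = U'' x - grad W (U x))) \<and>
     (U \<longlongrightarrow> pm) at_bot \<and> (U \<longlongrightarrow> pp) at_top"

end

theory Submission
  imports Defs
begin

text \<open>
  Near \<open>\<^bold>p\<^sub>+\<close> the potential is exactly quadratic, so \<open>u = U - \<^bold>p\<^sub>+\<close> eventually solves the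
  linear equation \<open>u'' = 2 H u - \<nu> J u'\<close>.  Rotations of the plane commute with \<open>J\<close>, so in an
  orthogonal eigenbasis of \<open>H\<close>, with eigenvalues \<open>a = \<lambda>\<^sub>1\<^sup>2\<close> and \<open>b = \<lambda>\<^sub>2\<^sup>2\<close>, it reads
  \<open>x'' = 2 a x - \<nu> y'\<close>, \<open>y'' = 2 b y + \<nu> x'\<close>.  Its characteristic exponents \<open>\<mu>\<close> satisfy
  \<open>\<mu>^4 + (\<nu>\<^sup>2 - 2 a - 2 b) \<mu>\<^sup>2 + 4 a b = 0\<close>, and \<open>\<nu>\<^sup>2 > 2 (\<lambda>\<^sub>1 + \<lambda>\<^sub>2)\<^sup>2\<close> is exactly the
  condition under which they are four distinct imaginary numbers
  \<open>\<plusminus>i \<omega>\<^sub>1\<close>, \<open>\<plusminus>i \<omega>\<^sub>2\<close>.  A fast wave would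
  thus be a superposition of oscillations near \<open>\<^bold>p\<^sub>+\<close>, unable to decay without
  vanishing identically.

  The proof makes this quantitative with a conserved quadratic form, and needs no explicit
  solutions.  The energy \<open>E(u) = |u'|\<^sup>2 / 2 - u \<bullet> H u\<close> is conserved but indefinite: it is positive on
  the faster of the two oscillation modes and negative on the slower.  The derivative \<open>u'\<close> solves the same
  equation, so \<open>E(u')\<close> is conserved as well, and it equals \<open>\<omega>\<^sup>2 E(u)\<close> on a mode of
  frequency \<open>\<omega>\<close>.  Subtracting \<open>(\<omega>\<^sub>1\<^sup>2 + \<omega>\<^sub>2\<^sup>2) / 2\<close> times \<open>E(u)\<close> from \<open>E(u')\<close> therefore reverses the
  sign on the slower mode only, and the result is a positive definite conserved form
  (\<open>mixed_energy_constant\<close>, \<open>mixed_energy_coercive\<close>).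

  Definiteness is used three times.  It bounds \<open>u'\<close> and hence \<open>u''\<close>, so that \<open>u \<longlongrightarrow> 0\<close> forces
  \<open>u' \<longlongrightarrow> 0\<close>; the form is then \<open>0\<close> in the limit, hence always, and so \<open>u = 0\<close> near \<open>+\<infinity>\<close>
  (\<open>decaying_fast_solution_vanishes\<close>).  Finally it shows that the set of times at which \<open>U\<close> rests at
  \<open>\<^bold>p\<^sub>+\<close> is open, since the linear equation holds around every such time.  That set is also closed
  and nonempty, so it is the whole line, which contradicts \<open>U \<longlongrightarrow> \<^bold>p\<^sub>-\<close> at \<open>-\<infinity>\<close>.
\<close>

section \<open>The linearised equation in eigenvector coordinates\<close>

text \<open>
  This is \<open>E(u') - (\<omega>\<^sub>1\<^sup>2 + \<omega>\<^sub>2\<^sup>2) / 2 * E(u)\<close> with \<open>E(u) = |u'|\<^sup>2 / 2 - a x\<^sup>2 - b y\<^sup>2\<close>, where the second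
  derivatives in \<open>E(u')\<close> are eliminated by the equation, so that it is a quadratic form in position
  and velocity.  The sum \<open>\<omega>\<^sub>1\<^sup>2 + \<omega>\<^sub>2\<^sup>2 = \<nu>\<^sup>2 - 2 a - 2 b\<close> is read off the characteristic polynomial.
\<close>
definition mixed_energy :: "real \<Rightarrow> real \<Rightarrow> real \<Rightarrow> real \<Rightarrow> real \<Rightarrow> real \<Rightarrow> real \<Rightarrow> real" where
  "mixed_energy a b \<nu> x y x' y' =
     ((2 * a * x - \<nu> * y')\<^sup>2 + (2 * b * y + \<nu> * x')\<^sup>2) / 2 - a * x'\<^sup>2 - b * y'\<^sup>2
     - (\<nu>\<^sup>2 - 2 * a - 2 * b) / 2 * ((x'\<^sup>2 + y'\<^sup>2) / 2 - a * x\<^sup>2 - b * y\<^sup>2)"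

lemma mixed_energy_constant:
  fixes x y x' y' :: "real \<Rightarrow> real"
  assumes "convex S"
    and x: "\<And>t. t \<in> S \<Longrightarrow> (x has_real_derivative x' t) (at t)"
    and y: "\<And>t. t \<in> S \<Longrightarrow> (y has_real_derivative y' t) (at t)"
    and x': "\<And>t. t \<in> S \<Longrightarrow> (x' has_real_derivative 2 * a * x t - \<nu> * y' t) (at t)"
    and y': "\<And>t. t \<in> S \<Longrightarrow> (y' has_real_derivative 2 * b * y t + \<nu> * x' t) (at t)"
    and "s \<in> S" "t \<in> S"
  shows "mixed_energy a b \<nu> (x s) (y s) (x' s) (y' s)
       = mixed_energy a b \<nu> (x t) (y t) (x' t) (y' t)"
proof -
  let ?Q = "\<lambda>t. mixed_energy a b \<nu> (x t) (y t) (x' t) (y' t)"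
  have "(?Q has_real_derivative 0) (at t within S)" if "t \<in> S" for t
  proof -
    have "(?Q has_real_derivative 0) (at t)"
      unfolding mixed_energy_def
      by (rule derivative_eq_intros x[OF that] y[OF that] x'[OF that] y'[OF that] refl
            numeral_neq_zero)+ (simp add: field_simps power2_eq_square)
    then show ?thesis
      by (rule has_field_derivative_at_within)
  qed
  from has_field_derivative_zero_constant[OF \<open>convex S\<close> this] assms(6,7)
  show ?thesis by metis
qed

text \<open>
  The smaller eigenvalue of a positive definite binary form is at least determinant over trace,
  because the larger one is at most the trace.
\<close>
lemma binary_form_coercive:
  fixes p q r X Y :: real
  assumes "p > 0" "r > 0" "q\<^sup>2 < p * r"
  shows "(p * r - q\<^sup>2) / (p + r) * (X\<^sup>2 + Y\<^sup>2) \<le> p * X\<^sup>2 + 2 * q * X * Y + r * Y\<^sup>2"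
proof -
  have "0 \<le> (p * X + q * Y)\<^sup>2 + (q * X + r * Y)\<^sup>2" by simp
  also have "\<dots> = (p + r) * (p * X\<^sup>2 + 2 * q * X * Y + r * Y\<^sup>2) - (p * r - q\<^sup>2) * (X\<^sup>2 + Y\<^sup>2)"
    by (simp add: power2_eq_square algebra_simps)
  finally show ?thesis
    using assms by (simp add: field_simps)
qed

text \<open>
  The variables separate in \<open>mixed_energy\<close>: it is a form in \<open>(x, y')\<close> plus a form in \<open>(y, x')\<close>.
  The first has diagonal coefficients \<open>2 l\<^sup>2 A\<close>, \<open>A\<close> and half cross term \<open>- l\<^sup>2 \<nu>\<close>, and the second
  arises by exchanging \<open>l\<close> and \<open>m\<close> and flipping the sign of \<open>\<nu>\<close>.  So this lemma is their
  definiteness.  Put \<open>n = |\<nu>| / sqrt 2\<close>.  The determinant is then positive iff \<open>l n < |A|\<close>, and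
  \<open>2 (A - l n) = (n - l)\<^sup>2 - m\<^sup>2\<close> is positive because \<open>n > l + m\<close>.
\<close>
lemma fast_speed_discriminant:
  fixes l m \<nu> :: real
  assumes "l > 0" "m > 0" and fast: "\<nu>\<^sup>2 > 2 * (l + m)\<^sup>2"
  defines "A \<equiv> \<nu>\<^sup>2 / 4 + (l\<^sup>2 - m\<^sup>2) / 2"
  shows "A > 0" "(l\<^sup>2 * \<nu>)\<^sup>2 < 2 * l\<^sup>2 * A * A"
proof -
  define n where "n = \<bar>\<nu>\<bar> / sqrt 2"
  have n2: "n\<^sup>2 = \<nu>\<^sup>2 / 2" by (simp add: n_def power_divide)
  have n: "n > l + m"
  proof (rule power2_less_imp_less)
    show "(l + m)\<^sup>2 < n\<^sup>2" using fast n2 by simp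
  qed (simp add: n_def)
  have "m\<^sup>2 < (n - l)\<^sup>2"
    using n \<open>m > 0\<close> by (intro power_strict_mono) auto
  then have "l * n < A"
    using n2 by (simp add: A_def power2_diff field_simps)
  moreover have ln: "0 < l * n" using assms n by simp
  ultimately show "A > 0" by simp
  have "(l * n)\<^sup>2 < A\<^sup>2"
    using \<open>l * n < A\<close> ln by (intro power_strict_mono) auto
  then have "2 * l\<^sup>2 * (l * n)\<^sup>2 < 2 * l\<^sup>2 * A\<^sup>2"
    using \<open>l > 0\<close> by simp
  then show "(l\<^sup>2 * \<nu>)\<^sup>2 < 2 * l\<^sup>2 * A * A"
    unfolding power_mult_distrib n2 by (simp add: power2_eq_square algebra_simps)
qed

lemma mixed_energy_coercive:
  fixes l m \<nu> :: real
  assumes "l > 0" "m > 0" "\<nu>\<^sup>2 > 2 * (l + m)\<^sup>2"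
  obtains k where "k > 0"
    "\<And>x y x' y'. k * (x\<^sup>2 + y\<^sup>2 + x'\<^sup>2 + y'\<^sup>2) \<le> mixed_energy (l\<^sup>2) (m\<^sup>2) \<nu> x y x' y'"
proof -
  define A where "A = \<nu>\<^sup>2 / 4 + (l\<^sup>2 - m\<^sup>2) / 2"
  define C where "C = \<nu>\<^sup>2 / 4 + (m\<^sup>2 - l\<^sup>2) / 2"
  have A: "A > 0" "(l\<^sup>2 * \<nu>)\<^sup>2 < 2 * l\<^sup>2 * A * A"
    unfolding A_def using fast_speed_discriminant[OF assms] by blast+
  have C: "C > 0" "(m\<^sup>2 * \<nu>)\<^sup>2 < 2 * m\<^sup>2 * C * C"
    unfolding C_def using fast_speed_discriminant[of m l \<nu>] assms by (auto simp: add.commute)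
  define k1 where "k1 = (2 * l\<^sup>2 * A * A - (- (l\<^sup>2 * \<nu>))\<^sup>2) / (2 * l\<^sup>2 * A + A)"
  define k2 where "k2 = (2 * m\<^sup>2 * C * C - (m\<^sup>2 * \<nu>)\<^sup>2) / (2 * m\<^sup>2 * C + C)"
  have "k1 > 0" "k2 > 0"
    using A C assms by (auto simp: k1_def k2_def intro!: divide_pos_pos add_pos_pos)
  show ?thesis
  proof
    show "min k1 k2 > 0" using \<open>k1 > 0\<close> \<open>k2 > 0\<close> by simp
    fix x y x' y' :: real
    have "min k1 k2 * (x\<^sup>2 + y\<^sup>2 + x'\<^sup>2 + y'\<^sup>2)
        = min k1 k2 * (x\<^sup>2 + y'\<^sup>2) + min k1 k2 * (y\<^sup>2 + x'\<^sup>2)"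
      by (simp add: algebra_simps)
    also have "\<dots> \<le> k1 * (x\<^sup>2 + y'\<^sup>2) + k2 * (y\<^sup>2 + x'\<^sup>2)"
      by (intro add_mono mult_right_mono) auto
    also have "\<dots> \<le> (2 * l\<^sup>2 * A * x\<^sup>2 + 2 * (- (l\<^sup>2 * \<nu>)) * x * y' + A * y'\<^sup>2)
                 + (2 * m\<^sup>2 * C * y\<^sup>2 + 2 * (m\<^sup>2 * \<nu>) * y * x' + C * x'\<^sup>2)"
      unfolding k1_def k2_def using A C assms
      by (intro add_mono binary_form_coercive) auto
    also have "\<dots> = mixed_energy (l\<^sup>2) (m\<^sup>2) \<nu> x y x' y'"
      unfolding mixed_energy_def A_def C_def by (simp add: power2_eq_square field_simps)
    finally show "min k1 k2 * (x\<^sup>2 + y\<^sup>2 + x'\<^sup>2 + y'\<^sup>2) \<le> mixed_energy (l\<^sup>2) (m\<^sup>2) \<nu> x y x' y'" .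
  qed
qed

text \<open>
  If the derivative were large at some time, the bound on the second derivative would keep it large
  for a fixed time, and the function would move by an amount incompatible with convergence.
\<close>
lemma derivative_tendsto_0_if_second_derivative_bounded:
  fixes f f' f'' :: "real \<Rightarrow> real"
  assumes f: "\<And>t. t \<ge> T \<Longrightarrow> (f has_real_derivative f' t) (at t)"
    and f': "\<And>t. t \<ge> T \<Longrightarrow> (f' has_real_derivative f'' t) (at t)"
    and M: "\<And>t. t \<ge> T \<Longrightarrow> \<bar>f'' t\<bar> \<le> M"
    and lim: "(f \<longlongrightarrow> L) at_top"
  shows "(f' \<longlongrightarrow> 0) at_top"
proof (rule tendstoI)
  fix e :: real assume "e > 0"
  have "M \<ge> 0" using M[of T] by linarith
  \<comment> \<open>Over a time \<open>h\<close> the derivative changes by less than \<open>e / 2\<close>.\<close>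
  define h where "h = e / (2 * (M + 1))"
  have "h > 0" and Mh: "M * h < e / 2"
    using \<open>e > 0\<close> \<open>M \<ge> 0\<close> by (auto simp: h_def field_simps)
  have "\<forall>\<^sub>F t in at_top. dist (f t) L < e * h / 4"
    using lim \<open>e > 0\<close> \<open>h > 0\<close> by (intro tendstoD) auto
  then obtain N where N: "\<And>t. t \<ge> N \<Longrightarrow> \<bar>f t - L\<bar> < e * h / 4"
    by (auto simp: eventually_at_top_linorder dist_real_def)
  have "dist (f' t) 0 < e" if "t \<ge> max T N" for t
  proof -
    have "\<exists>z. t < z \<and> z < t + h \<and> f (t + h) - f t = (t + h - t) * f' z"
      using that \<open>h > 0\<close> by (intro MVT2 f) auto
    then obtain z where z: "t < z" "z < t + h" "f (t + h) - f t = h * f' z" by auto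
    have "h * \<bar>f' z\<bar> = \<bar>f (t + h) - f t\<bar>" using z \<open>h > 0\<close> by (simp add: abs_mult)
    also have "\<dots> < e * h / 4 + e * h / 4"
      using N[of t] N[of "t + h"] that \<open>h > 0\<close> by linarith
    also have "\<dots> = h * (e / 2)" by simp
    finally have fz: "\<bar>f' z\<bar> < e / 2" using \<open>h > 0\<close> by simp
    have "\<exists>w. t < w \<and> w < z \<and> f' z - f' t = (z - t) * f'' w"
      using that z by (intro MVT2 f') auto
    then obtain w where w: "t < w" "w < z" "f' z - f' t = (z - t) * f'' w" by blast
    have "\<bar>f' z - f' t\<bar> = (z - t) * \<bar>f'' w\<bar>" using w z by (simp add: abs_mult)
    also have "\<dots> \<le> h * M" using M[of w] w z that by (intro mult_mono) auto
    finally have "\<bar>f' t\<bar> < e" using fz Mh by (simp add: mult.commute)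
    then show ?thesis by simp
  qed
  then show "\<forall>\<^sub>F t in at_top. dist (f' t) 0 < e"
    unfolding eventually_at_top_linorder by blast
qed

lemma decaying_fast_solution_vanishes:
  fixes x y x' y' :: "real \<Rightarrow> real"
  assumes l: "l > 0" "m > 0" "\<nu>\<^sup>2 > 2 * (l + m)\<^sup>2"
    and x: "\<And>t. t \<ge> T \<Longrightarrow> (x has_real_derivative x' t) (at t)"
    and y: "\<And>t. t \<ge> T \<Longrightarrow> (y has_real_derivative y' t) (at t)"
    and x': "\<And>t. t \<ge> T \<Longrightarrow> (x' has_real_derivative 2 * l\<^sup>2 * x t - \<nu> * y' t) (at t)"
    and y': "\<And>t. t \<ge> T \<Longrightarrow> (y' has_real_derivative 2 * m\<^sup>2 * y t + \<nu> * x' t) (at t)"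
    and lim: "(x \<longlongrightarrow> 0) at_top" "(y \<longlongrightarrow> 0) at_top"
    and "t \<ge> T"
  shows "x t = 0 \<and> y t = 0 \<and> x' t = 0 \<and> y' t = 0"
proof -
  let ?Q = "\<lambda>t. mixed_energy (l\<^sup>2) (m\<^sup>2) \<nu> (x t) (y t) (x' t) (y' t)"
  let ?N = "\<lambda>t. (x t)\<^sup>2 + (y t)\<^sup>2 + (x' t)\<^sup>2 + (y' t)\<^sup>2"
  obtain k where k: "k > 0"
    "\<And>x y x' y'. k * (x\<^sup>2 + y\<^sup>2 + x'\<^sup>2 + y'\<^sup>2) \<le> mixed_energy (l\<^sup>2) (m\<^sup>2) \<nu> x y x' y'"
    using mixed_energy_coercive[OF l] by blast
  have const: "?Q s = ?Q t" if "s \<ge> T" for s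
    using x y x' y' that \<open>t \<ge> T\<close> by (intro mixed_energy_constant[of "{T..}"]) auto
  \<comment> \<open>The conserved value bounds the whole trajectory; in the end it is \<open>0\<close>, and so is \<open>R\<close>.\<close>
  define R where "R = sqrt (?Q t / k)"
  have N: "?N s \<le> ?Q t / k" if "s \<ge> T" for s
    using k(2)[of "x s" "y s" "x' s" "y' s"] const[OF that] k(1) by (simp add: field_simps)
  have bound: "\<bar>x s\<bar> \<le> R" "\<bar>y s\<bar> \<le> R" "\<bar>x' s\<bar> \<le> R" "\<bar>y' s\<bar> \<le> R" if "s \<ge> T" for s
  proof -
    have "(x s)\<^sup>2 \<le> ?N s" "(y s)\<^sup>2 \<le> ?N s" "(x' s)\<^sup>2 \<le> ?N s" "(y' s)\<^sup>2 \<le> ?N s" by simp_all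
    moreover have "\<bar>z\<bar> \<le> R" if "z\<^sup>2 \<le> ?N s" for z
      unfolding R_def using order_trans[OF that N[OF \<open>s \<ge> T\<close>]] by (intro real_le_rsqrt) simp
    ultimately show "\<bar>x s\<bar> \<le> R" "\<bar>y s\<bar> \<le> R" "\<bar>x' s\<bar> \<le> R" "\<bar>y' s\<bar> \<le> R"
      by blast+
  qed
  have bound2: "\<bar>2 * a * z\<^sub>1 + c * z\<^sub>2\<bar> \<le> 2 * \<bar>a\<bar> * R + \<bar>c\<bar> * R" if "\<bar>z\<^sub>1\<bar> \<le> R" "\<bar>z\<^sub>2\<bar> \<le> R"
    for a c z\<^sub>1 z\<^sub>2
  proof -
    have "\<bar>2 * a * z\<^sub>1 + c * z\<^sub>2\<bar> \<le> 2 * \<bar>a\<bar> * \<bar>z\<^sub>1\<bar> + \<bar>c\<bar> * \<bar>z\<^sub>2\<bar>"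
      using abs_triangle_ineq[of "2 * a * z\<^sub>1" "c * z\<^sub>2"] by (simp add: abs_mult)
    also have "\<dots> \<le> 2 * \<bar>a\<bar> * R + \<bar>c\<bar> * R"
      using that by (intro add_mono mult_left_mono) auto
    finally show ?thesis .
  qed
  have x'': "\<bar>2 * l\<^sup>2 * x s - \<nu> * y' s\<bar> \<le> 2 * \<bar>l\<^sup>2\<bar> * R + \<bar>- \<nu>\<bar> * R" if "s \<ge> T" for s
    using bound2[OF bound(1)[OF that] bound(4)[OF that], of "l\<^sup>2" "- \<nu>"] by simp
  have limx': "(x' \<longlongrightarrow> 0) at_top"
    by (rule derivative_tendsto_0_if_second_derivative_bounded[OF x x' x'' lim(1)])
  have y'': "\<bar>2 * m\<^sup>2 * y s + \<nu> * x' s\<bar> \<le> 2 * \<bar>m\<^sup>2\<bar> * R + \<bar>\<nu>\<bar> * R" if "s \<ge> T" for s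
    using bound2[OF bound(2)[OF that] bound(3)[OF that]] by blast
  have limy': "(y' \<longlongrightarrow> 0) at_top"
    by (rule derivative_tendsto_0_if_second_derivative_bounded[OF y y' y'' lim(2)])
  have "(?Q \<longlongrightarrow> mixed_energy (l\<^sup>2) (m\<^sup>2) \<nu> 0 0 0 0) at_top"
    unfolding mixed_energy_def by (intro tendsto_intros lim limx' limy') simp_all
  moreover have "(?Q \<longlongrightarrow> ?Q t) at_top"
    by (rule tendsto_eventually) (use const in \<open>auto simp: eventually_at_top_linorder\<close>)
  ultimately have "?Q t = mixed_energy (l\<^sup>2) (m\<^sup>2) \<nu> 0 0 0 0"
    using tendsto_unique[OF trivial_limit_at_top_linorder] by blast
  then have "?Q t = 0" by (simp add: mixed_energy_def)
  then have "R = 0" by (simp add: R_def)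
  then show ?thesis using bound[OF \<open>t \<ge> T\<close>] by simp
qed

section \<open>From the plane to eigenvector coordinates\<close>

lemma J_mult_nth [simp]: "(J *v v) $ 1 = v $ 2" "(J *v v) $ 2 = - v $ 1"
  by (simp_all add: J_def matrix_vector_mult_def sum_2)

lemma J_skew: "(J *v v) \<bullet> w = - (v \<bullet> (J *v w))"
  by (simp add: inner_vec_def sum_2)

lemma J_J [simp]: "J *v (J *v v) = - v"
  by (simp add: vec_eq_iff forall_2)

text \<open>
  The vectors \<open>v\<close> and \<open>J v\<close> are orthogonal and of equal length; scaling by \<open>v \<bullet> v\<close> avoids normalising.
\<close>
lemma orthogonal_expansion:
  "(v \<bullet> v) *\<^sub>R z = (z \<bullet> v) *\<^sub>R v + (z \<bullet> (J *v v)) *\<^sub>R (J *v v)"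
  by (simp add: vec_eq_iff forall_2 inner_vec_def sum_2 algebra_simps)

lemma symmetric_inner:
  fixes H :: "real^'n^'n"
  assumes "transpose H = H"
  shows "(H *v u) \<bullet> v = u \<bullet> (H *v v)"
  by (metis assms dot_lmul_matrix transpose_matrix_vector)

text \<open>
  In the plane the orthogonal complement of an eigenvector \<open>v\<close> is spanned by \<open>J v\<close>, and symmetry makes it
  invariant, so \<open>J v\<close> is an eigenvector too.  Its eigenvalue is \<open>b\<close>: otherwise it is \<open>a\<close>, but
  then \<open>H\<close> is the scalar matrix \<open>a\<close> and \<open>b = a\<close>.
\<close>
lemma symmetric_eigenbasis:
  fixes H :: "real^2^2"
  assumes sym: "transpose H = H" and spec: "{c. eigenvalue H c} = {a, b}"
  obtains v where "v \<noteq> 0" "H *v v = a *\<^sub>R v" "H *v (J *v v) = b *\<^sub>R (J *v v)"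
proof -
  have "eigenvalue H a" "eigenvalue H b" using spec by auto
  then obtain v w where v: "v \<noteq> 0" "H *v v = a *\<^sub>R v" and w: "w \<noteq> 0" "H *v w = b *\<^sub>R w"
    unfolding eigenvalue_def by blast
  define c where "c = (H *v (J *v v)) \<bullet> (J *v v) / (v \<bullet> v)"
  have "v \<bullet> (J *v v) = 0" by (simp add: inner_vec_def sum_2)
  then have "(H *v (J *v v)) \<bullet> v = 0"
    using symmetric_inner[OF sym, of "J *v v" v] v by (simp add: inner_commute)
  then have "(v \<bullet> v) *\<^sub>R (H *v (J *v v)) = (v \<bullet> v) *\<^sub>R (c *\<^sub>R (J *v v))"
    using orthogonal_expansion[of v "H *v (J *v v)"] v by (simp add: c_def)
  then have Hc: "H *v (J *v v) = c *\<^sub>R (J *v v)"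
    using v(1) by (metis inner_eq_zero_iff scaleR_cancel_left)
  have "J *v v \<noteq> 0" using v J_J[of v] by (metis matrix_vector_mult_0_right neg_equal_0_iff_equal)
  then have "eigenvalue H c" using Hc unfolding eigenvalue_def by blast
  then have "c = a \<or> c = b" using spec by blast
  moreover have "c = b" if "c = a"
  proof -
    have "(v \<bullet> v) *\<^sub>R (H *v w) = H *v ((v \<bullet> v) *\<^sub>R w)"
      by (simp add: matrix_vector_mult_scaleR)
    also have "\<dots> = a *\<^sub>R ((v \<bullet> v) *\<^sub>R w)"
      unfolding orthogonal_expansion[of v w]
      using v Hc that by (simp add: matrix_vector_right_distrib matrix_vector_mult_scaleR
          scaleR_add_right mult.commute)
    finally have "a *\<^sub>R w = b *\<^sub>R w" using v w by (simp add: mult.commute)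
    with w that show ?thesis by simp
  qed
  ultimately show ?thesis using that v Hc by blast
qed

lemma grad_quadratic:
  fixes W :: "real^'n \<Rightarrow> real"
  assumes sym: "transpose H = H"
    and W: "\<forall>p. norm (p - p0) < r \<longrightarrow> W p = (p - p0) \<bullet> (H *v (p - p0))"
    and p: "norm (p - p0) < r"
  shows "grad W p = 2 *\<^sub>R (H *v (p - p0))"
proof -
  let ?q = "\<lambda>p. (p - p0) \<bullet> (H *v (p - p0))"
  let ?D = "\<lambda>h. h \<bullet> (2 *\<^sub>R (H *v (p - p0)))"
  have "((\<lambda>p. H *v (p - p0)) has_derivative (\<lambda>h. H *v h)) (at p)"
    by (rule bounded_linear.has_derivative[OF matrix_vector_mul_bounded_linear])
       (auto intro!: derivative_eq_intros)
  then have "(?q has_derivative (\<lambda>h. (p - p0) \<bullet> (H *v h) + h \<bullet> (H *v (p - p0)))) (at p)"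
    by (auto intro!: derivative_eq_intros)
  also have "(\<lambda>h. (p - p0) \<bullet> (H *v h) + h \<bullet> (H *v (p - p0))) = ?D"
    using symmetric_inner[OF sym, of "p - p0"] by (auto simp: inner_commute)
  finally have "(?q has_derivative ?D) (at p)" .
  then have "(W has_derivative ?D) (at p)"
    by (rule has_derivative_transform_within_open[of _ _ _ _ "ball p0 r"])
      (use p W in \<open>auto simp: dist_norm norm_minus_commute\<close>)
  then have "frechet_derivative W (at p) = ?D"
    by (metis frechet_derivative_at)
  then have "grad W p = (\<Sum>b\<in>Basis. ((2 *\<^sub>R (H *v (p - p0))) \<bullet> b) *\<^sub>R b)"
    unfolding grad_def by (simp add: inner_commute)
  then show ?thesis by (simp only: euclidean_representation)
qed

section \<open>The speed bound\<close>

theorem proposition4p11: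
  fixes W :: "real^2 \<Rightarrow> real"
    and pp pm :: "real^2"
    and rp rm :: real
    and Hp Hm :: "real^2^2"
    and l1 l2 \<nu> :: real
  assumes "Ck 3 W"
    and "\<forall>p. W p \<ge> 0"
    and "pp \<noteq> pm"
    and "\<forall>p. W p = 0 \<longleftrightarrow> p = pp \<or> p = pm"
    and "rp > 0" and "rm > 0"
    and "sym_pos_def Hp" and "sym_pos_def Hm"
    and "\<forall>p. norm (p - pp) < rp \<longrightarrow> W p = (p - pp) \<bullet> (Hp *v (p - pp))"
    and "\<forall>p. norm (p - pm) < rm \<longrightarrow> W p = (p - pm) \<bullet> (Hm *v (p - pm))"
    and "l1 > 0" and "l2 > 0"
    and "{c. eigenvalue Hp c} = {l1\<^sup>2, l2\<^sup>2}"
    and "\<exists>U. heteroclinic_wave W pm pp \<nu> U"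
  shows "\<nu>\<^sup>2 \<le> 2 * (l1 + l2)\<^sup>2"
proof (rule ccontr)
  assume "\<not> ?thesis"
  then have l: "l1 > 0" "l2 > 0" "\<nu>\<^sup>2 > 2 * (l1 + l2)\<^sup>2" using assms by auto
  have sym: "transpose Hp = Hp" using assms by (simp add: sym_pos_def_def)
  obtain U U' U'' where
    U: "\<And>t. (U has_vector_derivative U' t) (at t)" and
    U': "\<And>t. (U' has_vector_derivative U'' t) (at t)" and
    ode: "\<And>t. - (\<nu> *\<^sub>R (J *v U' t)) = U'' t - grad W (U t)" and
    lim: "(U \<longlongrightarrow> pm) at_bot" "(U \<longlongrightarrow> pp) at_top"
    using assms(14) unfolding heteroclinic_wave_def by blast
  obtain v where v: "v \<noteq> 0" "Hp *v v = l1\<^sup>2 *\<^sub>R v" "Hp *v (J *v v) = l2\<^sup>2 *\<^sub>R (J *v v)"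
    using symmetric_eigenbasis[OF sym assms(13)] by blast
  \<comment> \<open>With this sign \<open>(J *v u') \<bullet> v = y'\<close> and \<open>(J *v u') \<bullet> w = - x'\<close>,
    which gives the scalar system of the linearised equation.\<close>
  define w where "w = - (J *v v)"
  define x y x' y' where "x t = (U t - pp) \<bullet> v" and "y t = (U t - pp) \<bullet> w"
    and "x' t = U' t \<bullet> v" and "y' t = U' t \<bullet> w" for t
  have zero_iff: "z = 0" if "z \<bullet> v = 0" "z \<bullet> w = 0" for z
    using orthogonal_expansion[of v z] that v by (simp add: w_def)
  have dx: "(x has_real_derivative x' t) (at t)" and dy: "(y has_real_derivative y' t) (at t)" for t
    unfolding x_def y_def x'_def y'_def has_real_derivative_iff_has_vector_derivative
    by (auto intro!: derivative_eq_intros U bounded_linear.has_vector_derivative[OF bounded_linear_inner_left])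
  have U'': "U'' t = 2 *\<^sub>R (Hp *v (U t - pp)) - \<nu> *\<^sub>R (J *v U' t)" if "norm (U t - pp) < rp" for t
    using ode[of t] grad_quadratic[OF sym assms(9) that] by (simp add: algebra_simps)
  have dx': "(x' has_real_derivative 2 * l1\<^sup>2 * x t - \<nu> * y' t) (at t)"
    and dy': "(y' has_real_derivative 2 * l2\<^sup>2 * y t + \<nu> * x' t) (at t)"
    if "norm (U t - pp) < rp" for t
  proof -
    have "(x' has_real_derivative U'' t \<bullet> v) (at t)" "(y' has_real_derivative U'' t \<bullet> w) (at t)"
      unfolding x'_def y'_def has_real_derivative_iff_has_vector_derivative
      by (auto intro!: U' bounded_linear.has_vector_derivative[OF bounded_linear_inner_left])
    moreover have "U'' t \<bullet> v = 2 * l1\<^sup>2 * x t - \<nu> * y' t"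
      unfolding U''[OF that] x_def y'_def w_def
      by (simp add: inner_diff_left symmetric_inner[OF sym] v J_skew)
    moreover have "U'' t \<bullet> w = 2 * l2\<^sup>2 * y t + \<nu> * x' t"
      unfolding U''[OF that] x'_def y_def w_def
      by (simp add: inner_diff_left symmetric_inner[OF sym] v J_skew algebra_simps)
    ultimately show "(x' has_real_derivative 2 * l1\<^sup>2 * x t - \<nu> * y' t) (at t)"
      "(y' has_real_derivative 2 * l2\<^sup>2 * y t + \<nu> * x' t) (at t)" by simp_all
  qed
  \<comment> \<open>The times at which the wave rests at the equilibrium; a connectedness argument shows that these
    are all times.\<close>
  define Z where "Z = {t. U t = pp \<and> U' t = 0}"
  have contU: "continuous_on UNIV U" and contU': "continuous_on UNIV U'"
    using U U' by (auto intro!: continuous_at_imp_continuous_on has_vector_derivative_continuous)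
  have "Z \<noteq> {}"
  proof -
    have "\<forall>\<^sub>F t in at_top. dist (U t) pp < rp" using lim(2) \<open>rp > 0\<close> by (rule tendstoD)
    then obtain T where T: "\<And>t. t \<ge> T \<Longrightarrow> norm (U t - pp) < rp"
      by (auto simp: eventually_at_top_linorder dist_norm)
    have "((\<lambda>t. (U t - pp) \<bullet> z) \<longlongrightarrow> (pp - pp) \<bullet> z) at_top" for z
      by (intro tendsto_intros lim)
    then have "(x \<longlongrightarrow> 0) at_top" "(y \<longlongrightarrow> 0) at_top"
      unfolding x_def[abs_def] y_def[abs_def] by simp_all
    then have "x T = 0 \<and> y T = 0 \<and> x' T = 0 \<and> y' T = 0"
      using dx dy dx' dy' T by (intro decaying_fast_solution_vanishes[OF l, of T]) auto
    then have "T \<in> Z"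
      using zero_iff[of "U T - pp"] zero_iff[of "U' T"]
      by (simp add: Z_def x_def y_def x'_def y'_def)
    then show ?thesis by blast
  qed
  moreover have "closed Z"
    unfolding Z_def Collect_conj_eq
    by (intro closed_Int closed_Collect_eq contU contU' continuous_on_const)
  moreover have "open Z"
    unfolding open_dist
  proof
    fix t assume t: "t \<in> Z"
    have "isCont U t" using U has_vector_derivative_continuous by blast
    then obtain d where "d > 0" and d: "\<And>s. dist s t < d \<Longrightarrow> dist (U s) (U t) < rp"
      using \<open>rp > 0\<close> unfolding continuous_at_eps_delta by blast
    then have near: "norm (U s - pp) < rp" if "s \<in> ball t d" for s
      using that t by (auto simp: Z_def dist_norm norm_minus_commute)
    obtain k where k: "k > 0"
      "\<And>x y x' y'. k * (x\<^sup>2 + y\<^sup>2 + x'\<^sup>2 + y'\<^sup>2) \<le> mixed_energy (l1\<^sup>2) (l2\<^sup>2) \<nu> x y x' y'"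
      using mixed_energy_coercive[OF l] by blast
    have "s \<in> Z" if "dist s t < d" for s
    proof -
      have "mixed_energy (l1\<^sup>2) (l2\<^sup>2) \<nu> (x s) (y s) (x' s) (y' s)
          = mixed_energy (l1\<^sup>2) (l2\<^sup>2) \<nu> (x t) (y t) (x' t) (y' t)"
        using dx dy dx' dy' near that \<open>d > 0\<close>
        by (intro mixed_energy_constant[of "ball t d"]) (auto simp: dist_commute)
      also have "\<dots> = 0"
        using t by (simp add: Z_def x_def y_def x'_def y'_def mixed_energy_def)
      finally have "k * ((x s)\<^sup>2 + (y s)\<^sup>2 + (x' s)\<^sup>2 + (y' s)\<^sup>2) \<le> 0" using k(2) by metis
      then have "(x s)\<^sup>2 + (y s)\<^sup>2 + (x' s)\<^sup>2 + (y' s)\<^sup>2 \<le> 0"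
        using k(1) by (simp add: mult_le_0_iff)
      then have "(x s)\<^sup>2 = 0" "(y s)\<^sup>2 = 0" "(x' s)\<^sup>2 = 0" "(y' s)\<^sup>2 = 0"
        using zero_le_power2[of "x s"] zero_le_power2[of "y s"]
          zero_le_power2[of "x' s"] zero_le_power2[of "y' s"] by linarith+
      then show ?thesis
        using zero_iff[of "U s - pp"] zero_iff[of "U' s"]
        by (simp add: Z_def x_def y_def x'_def y'_def)
    qed
    then show "\<exists>e>0. \<forall>s. dist s t < e \<longrightarrow> s \<in> Z" using \<open>d > 0\<close> by blast
  qed
  ultimately have "Z = UNIV" using clopen by blast
  then have "U = (\<lambda>t. pp)" by (auto simp: Z_def)
  then have "(U \<longlongrightarrow> pp) at_bot" by simp
  with lim(1) have "pp = pm"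
    using tendsto_unique[OF trivial_limit_at_bot_linorder] by blast
  with \<open>pp \<noteq> pm\<close> show False by contradiction
qed

end
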